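(* Let $F>0$ and let $\phi,\rho,G$ (pair potential, electron density, embedding function) satisfy $$\phi''_{F}>0,\quad \phi''_{2F}<0,\quad \rho'_{F}\le 0,\quad \rho'_{2F}\le 0,\quad \rho''_{F}\ge 0,\quad \rho''_{2F}\ge 0,\quad G''_{F}\ge 0,$$ and $$\phi''_{2F}+G''_{F}(\rho'_{F}+2\rho'_{2F})^2+2G'_{F}\rho''_{2F}>0 .$$ Then: (i) $\phi''_{2F}+G''_{F}\left[(\rho'_{F})^2+20(\rho'_{2F})^2+12\rho'_{F}\rho'_{2F}\right]+2G'_{F}\rho''_{2F}>0$. (ii) For every integer $N\ge1$ (with $\epsilon=1/N$), $$\inf_{\mathbf{u}\in\mathcal{U},\ \|D\mathbf{u}\|_{\ell^2_\epsilon}=1}\langle\delta^2\mathcal{E}^{qcl}(\mathbf{y}_F)\mathbf{u},\mathbf{u}\rangle\;>\;\phi''_F+2G'_F\rho''_F\;\ge\;\inf_{\mathbf{u}\in\mathcal{U},\ \|D\mathbf{u}\|_{\ell^2_\epsilon}=1}\langle\delta^2\mathcal{E}^{a}(\mathbf{y}_F)\mathbf{u},\mathbf{u}\rangle .$$ (iii) If $K$ is sufficiently large, the EAM-QNL model is also less stable than the EAM-QCL model: there is $K_0$ such that for all integers $K\ge K_0$ and $N\ge K+3$ (with $\epsilon=1/N$), $$\inf_{\mathbf{u}\in\mathcal{U},\ \|D\mathbf{u}\|_{\ell^2_\epsilon}=1}\langle\delta^2\mathcal{E}^{qnl}(\mathbf{y}_F)\mathbf{u},\mathbf{u}\rangle\;<\;\inf_{\mathbf{u}\in\mathcal{U},\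 \|D\mathbf{u}\|_{\ell^2_\epsilon}=1}\langle\delta^2\mathcal{E}^{qcl}(\mathbf{y}_F)\mathbf{u},\mathbf{u}\rangle .$$
   Context: Setting. Let $N\ge1$ be an integer, $\epsilon=1/N$, $F>0$. $\mathcal{U}$ is the space of real sequences $\mathbf{u}=(u_\ell)_{\ell\in\mathbb{Z}}$ with $u_{\ell+2N}=u_\ell$ and $\sum_{\ell=-N+1}^N u_\ell=0$. Put $(\mathbf{y}_F)_\ell=F\epsilon\ell$ and $\mathcal{Y}_F=\{\mathbf{y}_F+\mathbf{u}:\mathbf{u}\in\mathcal{U}\}$. For a sequence $\mathbf{v}$ write $v'_\ell=Dv_\ell=(v_\ell-v_{\ell-1})/\epsilon$, and for $2N$-periodic $\mathbf{v}$ put $\|\mathbf{v}\|_{\ell^2_\epsilon}=\big(\epsilon\sum_{\ell=-N+1}^N|v_\ell|^2\big)^{1/2}$. Let $\phi,\rho,G$ be smooth real-valued functions ($\phi,\rho$ on $(0,\infty)$, $G$ on $\mathbb{R}$), not depending on $N$ or $K$; energies are considered for $\mathbf{y}\in\mathcal{Y}_F$ with all $y'_\ell>0$. Densities: $$\bar\rho^a_\ell(\mathbf{y})=\rho(y'_\ell)+\rho(y'_\ell+y'_{\ell-1})+\rho(y'_{\ell+1})+\rho(y'_{\ell+1}+y'_{\ell+2}),$$ $$\bar\rho^c_\ell(\mathbf{y})=2\rho(y'_\ell)+2\rho(2y'_\ell),\qquad \bar\rho^{qnl}_\ell(\mathbf{y})=2\rho(y'_\ell)+2\rho(y'_\ell+y'_{\ell-1}).$$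 Per-atom energies: $$\mathcal{E}^a_\ell(\mathbf{y})=G(\bar\rho^a_\ell(\mathbf{y}))+\tfrac12[\phi(y'_\ell)+\phi(y'_\ell+y'_{\ell-1})+\phi(y'_{\ell+1})+\phi(y'_{\ell+1}+y'_{\ell+2})],$$ $$\mathcal{E}^c_\ell(\mathbf{y})=\tfrac12G(\bar\rho^c_\ell(\mathbf{y}))+\tfrac12G(\bar\rho^c_{\ell+1}(\mathbf{y}))+\tfrac12[\phi(y'_\ell)+\phi(2y'_\ell)+\phi(y'_{\ell+1})+\phi(2y'_{\ell+1})].$$ Atomistic energy: $\mathcal{E}^a=\epsilon\sum_{\ell=-N+1}^N\mathcal{E}^a_\ell$. EAM-QCL (local quasicontinuum) energy: $\mathcal{E}^{qcl}=\epsilon\sum_{\ell=-N+1}^N\mathcal{E}^c_\ell$. EAM-QNL energy, for an integer $K$ with $0\le K\le N-3$: $\mathcal{E}^{qnl}(\mathbf{y})=\epsilon\sum_{\ell=-N+1}^N\mathcal{E}^{qnl}_\ell(\mathbf{y})$, where $\mathcal{E}^{qnl}_\ell=\mathcal{E}^a_\ell$ for $0\le\ell\le K$; for $\ell\in\{K+1,K+2\}$, $$\mathcal{E}^{qnl}_\ell(\mathbf{y})=\tfrac12G(\bar\rho^{qnl}_\ell(\mathbf{y}))+\tfrac12G(\bar\rho^c_{\ell+1}(\mathbf{y}))+\tfrac12[\phi(y'_\ell)+\phi(y'_{\ell+1})+\phi(y'_\ell+y'_{\ell-1})+\phi(2y'_{\ell+1})];$$ $\mathcal{E}^{qnl}_\ell=\mathcal{E}^c_\ell$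 for $K+3\le\ell\le N$; and for $-N+1\le\ell\le-1$ it is defined symmetrically by reflection: $\mathcal{E}^{qnl}_{\ell}(\mathbf{y})$ is obtained from the formula for $\mathcal{E}^{qnl}_{-\ell}(\mathbf{y})$ by replacing every $y'_j$ by $y'_{1-j}$. For an energy $\mathcal{E}$, the second variation is $\langle\delta^2\mathcal{E}(\mathbf{y})\mathbf{v},\mathbf{w}\rangle=\sum_{\ell,m=-N+1}^N\frac{\partial^2\mathcal{E}}{\partial y_\ell\partial y_m}(\mathbf{y})v_\ell w_m=\frac{\partial^2}{\partial s\,\partial t}\mathcal{E}(\mathbf{y}+s\mathbf{v}+t\mathbf{w})\big|_{s=t=0}$ for $\mathbf{v},\mathbf{w}\in\mathcal{U}$. Notation: $\phi''_F=\phi''(F)$, $\phi''_{2F}=\phi''(2F)$, $\rho'_F=\rho'(F)$, $\rho'_{2F}=\rho'(2F)$, $\rho''_F=\rho''(F)$, $\rho''_{2F}=\rho''(2F)$, $G'_F=G'(\bar\rho_F)$, $G''_F=G''(\bar\rho_F)$, where $\bar\rho_F=2\rho(F)+2\rho(2F)$ (the common value of $\bar\rho^a_\ell,\bar\rho^c_\ell,\bar\rho^{qnl}_\ell$ at $\mathbf{y}_F$). *)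

theory Defs
  imports "HOL-Analysis.Analysis"
begin

(* All orders of differentiability on an open set S of reals. *)
definition smooth_on :: "real set \<Rightarrow> (real \<Rightarrow> real) \<Rightarrow> bool" where
  "smooth_on S f \<longleftrightarrow> (\<forall>n. \<forall>x\<in>S. (deriv ^^ n) f field_differentiable (at x))"

definition eps :: "nat \<Rightarrow> real" where
  "eps N = 1 / real N"

definition cell :: "nat \<Rightarrow> int set" where
  "cell N = {- int N + 1 .. int N}"

definition displacements :: "nat \<Rightarrow> (int \<Rightarrow> real) set" where
  "displacements N = {u. (\<forall>l. u (l + 2 * int N) = u l) \<and> (\<Sum>l\<in>cell N. u l) = 0}"

definition uniform_deformation :: "real \<Rightarrow> nat \<Rightarrow> int \<Rightarrow> real" where
  "uniform_deformation F N l = F * eps N * real_of_int l"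

definition diff_quot :: "nat \<Rightarrow> (int \<Rightarrow> real) \<Rightarrow> int \<Rightarrow> real" where
  "diff_quot N v l = (v l - v (l - 1)) / eps N"

definition l2_norm :: "nat \<Rightarrow> (int \<Rightarrow> real) \<Rightarrow> real" where
  "l2_norm N v = sqrt (eps N * (\<Sum>l\<in>cell N. \<bar>v l\<bar>\<^sup>2))"

(* The densities and per-atom energies depend on y only through r = Dy,
   so they are defined as functions of the strain sequence r. *)

definition dens_a :: "(real \<Rightarrow> real) \<Rightarrow> (int \<Rightarrow> real) \<Rightarrow> int \<Rightarrow> real" where
  "dens_a \<rho> r l = \<rho> (r l) + \<rho> (r l + r (l - 1)) + \<rho> (r (l + 1)) + \<rho> (r (l + 1) + r (l + 2))"

definition dens_c :: "(real \<Rightarrow> real) \<Rightarrow> (int \<Rightarrow> real) \<Rightarrow> int \<Rightarrow> real" where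
  "dens_c \<rho> r l = 2 * \<rho> (r l) + 2 * \<rho> (2 * r l)"

definition dens_qnl :: "(real \<Rightarrow> real) \<Rightarrow> (int \<Rightarrow> real) \<Rightarrow> int \<Rightarrow> real" where
  "dens_qnl \<rho> r l = 2 * \<rho> (r l) + 2 * \<rho> (r l + r (l - 1))"

definition dens_uniform :: "(real \<Rightarrow> real) \<Rightarrow> real \<Rightarrow> real" where
  "dens_uniform \<rho> F = 2 * \<rho> F + 2 * \<rho> (2 * F)"

definition atom_a ::
  "(real \<Rightarrow> real) \<Rightarrow> (real \<Rightarrow> real) \<Rightarrow> (real \<Rightarrow> real) \<Rightarrow> (int \<Rightarrow> real) \<Rightarrow> int \<Rightarrow> real" where
  "atom_a \<phi> \<rho> G r l =
     G (dens_a \<rho> r l)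
     + 1/2 * (\<phi> (r l) + \<phi> (r l + r (l - 1)) + \<phi> (r (l + 1)) + \<phi> (r (l + 1) + r (l + 2)))"

definition atom_c ::
  "(real \<Rightarrow> real) \<Rightarrow> (real \<Rightarrow> real) \<Rightarrow> (real \<Rightarrow> real) \<Rightarrow> (int \<Rightarrow> real) \<Rightarrow> int \<Rightarrow> real" where
  "atom_c \<phi> \<rho> G r l =
     1/2 * G (dens_c \<rho> r l) + 1/2 * G (dens_c \<rho> r (l + 1))
     + 1/2 * (\<phi> (r l) + \<phi> (2 * r l) + \<phi> (r (l + 1)) + \<phi> (2 * r (l + 1)))"

definition atom_interface ::
  "(real \<Rightarrow> real) \<Rightarrow> (real \<Rightarrow> real) \<Rightarrow> (real \<Rightarrow> real) \<Rightarrow> (int \<Rightarrow> real) \<Rightarrow> int \<Rightarrow> real" where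
  "atom_interface \<phi> \<rho> G r l =
     1/2 * G (dens_qnl \<rho> r l) + 1/2 * G (dens_c \<rho> r (l + 1))
     + 1/2 * (\<phi> (r l) + \<phi> (r (l + 1)) + \<phi> (r l + r (l - 1)) + \<phi> (2 * r (l + 1)))"

definition atom_qnl_right ::
  "(real \<Rightarrow> real) \<Rightarrow> (real \<Rightarrow> real) \<Rightarrow> (real \<Rightarrow> real) \<Rightarrow> nat \<Rightarrow> (int \<Rightarrow> real) \<Rightarrow> int \<Rightarrow> real" where
  "atom_qnl_right \<phi> \<rho> G K r l =
     (if l \<le> int K then atom_a \<phi> \<rho> G r l
      else if l \<le> int K + 2 then atom_interface \<phi> \<rho> G r l
      else atom_c \<phi> \<rho> G r l)"

(* Atom reflection l -> -l sends the bond (l-1, l) to (-l, 1-l), i.e. strain index j to 1 - j. *)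
definition atom_qnl ::
  "(real \<Rightarrow> real) \<Rightarrow> (real \<Rightarrow> real) \<Rightarrow> (real \<Rightarrow> real) \<Rightarrow> nat \<Rightarrow> (int \<Rightarrow> real) \<Rightarrow> int \<Rightarrow> real" where
  "atom_qnl \<phi> \<rho> G K r l =
     (if 0 \<le> l then atom_qnl_right \<phi> \<rho> G K r l
      else atom_qnl_right \<phi> \<rho> G K (\<lambda>j. r (1 - j)) (- l))"

definition energy_a ::
  "(real \<Rightarrow> real) \<Rightarrow> (real \<Rightarrow> real) \<Rightarrow> (real \<Rightarrow> real) \<Rightarrow> nat \<Rightarrow> (int \<Rightarrow> real) \<Rightarrow> real" where
  "energy_a \<phi> \<rho> G N y = eps N * (\<Sum>l\<in>cell N. atom_a \<phi> \<rho> G (diff_quot N y) l)"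

definition energy_qcl ::
  "(real \<Rightarrow> real) \<Rightarrow> (real \<Rightarrow> real) \<Rightarrow> (real \<Rightarrow> real) \<Rightarrow> nat \<Rightarrow> (int \<Rightarrow> real) \<Rightarrow> real" where
  "energy_qcl \<phi> \<rho> G N y = eps N * (\<Sum>l\<in>cell N. atom_c \<phi> \<rho> G (diff_quot N y) l)"

definition energy_qnl ::
  "(real \<Rightarrow> real) \<Rightarrow> (real \<Rightarrow> real) \<Rightarrow> (real \<Rightarrow> real) \<Rightarrow> nat \<Rightarrow> nat \<Rightarrow> (int \<Rightarrow> real) \<Rightarrow> real" where
  "energy_qnl \<phi> \<rho> G K N y = eps N * (\<Sum>l\<in>cell N. atom_qnl \<phi> \<rho> G K (diff_quot N y) l)"

definition second_variation ::
  "((int \<Rightarrow> real) \<Rightarrow> real) \<Rightarrow> (int \<Rightarrow> real) \<Rightarrow> (int \<Rightarrow> real) \<Rightarrow> (int \<Rightarrow> real) \<Rightarrow> real" where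
  "second_variation E y v w =
     deriv (\<lambda>s. deriv (\<lambda>t. E (\<lambda>l. y l + s * v l + t * w l)) 0) 0"

(* For N > 0 the index set is non-empty and, the second variation being a quadratic form on a
   finite-dimensional space, the family is bounded below, so the real infimum is the true one. *)
definition stability_const :: "real \<Rightarrow> nat \<Rightarrow> ((int \<Rightarrow> real) \<Rightarrow> real) \<Rightarrow> real" where
  "stability_const F N E =
     (INF u\<in>{u \<in> displacements N. l2_norm N (diff_quot N u) = 1}.
        second_variation E (uniform_deformation F N) u u)"

end

(* Only the strain v = Du enters, so each second variation is epsilon times a sum over the atoms of
   local quadratic forms in v. With 2 alpha = phi''_F + 2 G'_F rho''_F and
   g = phi''_2F + G''_F (rho'_F + 2 rho'_2F)^2 + 2 G'_F rho''_2F > 0, the QCL form is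
   (2 alpha + 4 g) times the squared norm of v. The alternating strain leaves every atomistic density
   and every next-nearest-neighbour distance unchanged to first order, so its atomistic value is
   2 alpha. For QNL no long oscillation is needed: the single pair v_2 = -v_3 inside the atomistic
   region gives 2 alpha + phi''_2F + 2 G'_F rho''_2F + G''_F (rho'_F^2 + rho'_2F^2), which is at most
   2 alpha + g because rho'_F and rho'_2F have the same sign; so K_0 = 4 works for all N. *)
theory Submission
  imports Defs
begin

section \<open>Second derivatives of compositions\<close>

text \<open>Differentiability on a neighbourhood of \<open>x\<close> makes the iterated
  \<open>deriv\<close> a genuine second derivative; the first-order value is carried along because
  the chain rule consumes it.\<close>

definition has_second_deriv :: "(real \<Rightarrow> real) \<Rightarrow> real \<Rightarrow> real \<Rightarrow> real \<Rightarrow> bool" where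
  "has_second_deriv f d1 d2 x \<longleftrightarrow>
     (\<exists>f'. (\<forall>\<^sub>F y in nhds x. (f has_real_derivative f' y) (at y)) \<and> f' x = d1
        \<and> (f' has_real_derivative d2) (at x))"

lemma has_second_derivI:
  assumes "\<And>y. (f has_real_derivative f' y) (at y)" "(f' has_real_derivative d2) (at x)"
  shows "has_second_deriv f (f' x) d2 x"
  using assms unfolding has_second_deriv_def by (intro exI[of _ f']) auto

text \<open>Lets the structural rules compute the derivatives by unification first; agreement with
  the intended closed forms is left as algebra.\<close>

lemma has_second_deriv_cong:
  "has_second_deriv f d1 d2 x \<Longrightarrow> d1 = e1 \<Longrightarrow> d2 = e2 \<Longrightarrow> has_second_deriv f e1 e2 x"
  by simp

lemma has_second_deriv_imp_deriv_deriv: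
  assumes "has_second_deriv f d1 d2 x"
  shows "deriv (deriv f) x = d2"
proof -
  from assms obtain f' where f': "\<forall>\<^sub>F y in nhds x. (f has_real_derivative f' y) (at y)"
    "(f' has_real_derivative d2) (at x)"
    unfolding has_second_deriv_def by blast
  have "\<forall>\<^sub>F y in nhds x. deriv f y = f' y"
    using f'(1) by eventually_elim (rule DERIV_imp_deriv)
  then have "deriv (deriv f) x = deriv f' x"
    by (rule deriv_cong_ev) simp
  then show ?thesis
    using DERIV_imp_deriv[OF f'(2)] by simp
qed

lemma has_second_deriv_add:
  assumes "has_second_deriv f d1 d2 x" "has_second_deriv g e1 e2 x"
  shows "has_second_deriv (\<lambda>y. f y + g y) (d1 + e1) (d2 + e2) x"
proof -
  from assms obtain f' g' where
    f': "\<forall>\<^sub>F y in nhds x. (f has_real_derivative f' y) (at y)" "f' x = d1"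
      "(f' has_real_derivative d2) (at x)" and
    g': "\<forall>\<^sub>F y in nhds x. (g has_real_derivative g' y) (at y)" "g' x = e1"
      "(g' has_real_derivative e2) (at x)"
    unfolding has_second_deriv_def by blast
  have "\<forall>\<^sub>F y in nhds x. ((\<lambda>y. f y + g y) has_real_derivative f' y + g' y) (at y)"
    using f'(1) g'(1) by eventually_elim (rule DERIV_add)
  moreover have "((\<lambda>y. f' y + g' y) has_real_derivative d2 + e2) (at x)"
    using f'(3) g'(3) by (rule DERIV_add)
  ultimately show ?thesis
    unfolding has_second_deriv_def using f'(2) g'(2)
    by (intro exI[of _ "\<lambda>y. f' y + g' y"]) auto
qed

lemma has_second_deriv_cmult:
  assumes "has_second_deriv f d1 d2 x"
  shows "has_second_deriv (\<lambda>y. c * f y) (c * d1) (c * d2) x"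
proof -
  from assms obtain f' where
    f': "\<forall>\<^sub>F y in nhds x. (f has_real_derivative f' y) (at y)" "f' x = d1"
      "(f' has_real_derivative d2) (at x)"
    unfolding has_second_deriv_def by blast
  have "\<forall>\<^sub>F y in nhds x. ((\<lambda>y. c * f y) has_real_derivative c * f' y) (at y)"
    using f'(1) by eventually_elim (rule DERIV_cmult)
  moreover have "((\<lambda>y. c * f' y) has_real_derivative c * d2) (at x)"
    using f'(3) by (rule DERIV_cmult)
  ultimately show ?thesis
    unfolding has_second_deriv_def using f'(2)
    by (intro exI[of _ "\<lambda>y. c * f' y"]) auto
qed

lemma has_second_deriv_sum:
  assumes "finite S" "\<And>i. i \<in> S \<Longrightarrow> has_second_deriv (f i) (d1 i) (d2 i) x"
  shows "has_second_deriv (\<lambda>y. \<Sum>i\<in>S. f i y) (\<Sum>i\<in>S. d1 i) (\<Sum>i\<in>S. d2 i) x"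
  using assms
proof (induction S rule: finite_induct)
  case empty
  show ?case
    using has_second_derivI[of "\<lambda>_. 0" "\<lambda>_. 0" 0 x] by simp
next
  case (insert i S)
  then show ?case
    using has_second_deriv_add[of "f i" "d1 i" "d2 i" x] by simp
qed

lemma has_second_deriv_compose:
  assumes "has_second_deriv g e1 e2 (h x)" "has_second_deriv h d1 d2 x"
  shows "has_second_deriv (\<lambda>y. g (h y)) (e1 * d1) (e2 * d1\<^sup>2 + e1 * d2) x"
proof -
  from assms obtain g' h' where
    g': "\<forall>\<^sub>F z in nhds (h x). (g has_real_derivative g' z) (at z)" "g' (h x) = e1"
      "(g' has_real_derivative e2) (at (h x))" and
    h': "\<forall>\<^sub>F y in nhds x. (h has_real_derivative h' y) (at y)" "h' x = d1"
      "(h' has_real_derivative d2) (at x)"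
    unfolding has_second_deriv_def by blast
  have hx: "(h has_real_derivative d1) (at x)"
    using eventually_nhds_x_imp_x[OF h'(1)] h'(2) by simp
  \<comment> \<open>Continuity of \<open>h\<close> at \<open>x\<close> pulls the neighbourhood on
    which \<open>g\<close> is differentiable back to a neighbourhood of \<open>x\<close>.\<close>
  have "filterlim h (nhds (h x)) (nhds x)"
    using DERIV_isCont[OF hx] unfolding isCont_def tendsto_at_iff_tendsto_nhds .
  with g'(1) have "\<forall>\<^sub>F y in nhds x. (g has_real_derivative g' (h y)) (at (h y))"
    by (rule eventually_compose_filterlim)
  with h'(1) have "\<forall>\<^sub>F y in nhds x.
      ((\<lambda>y. g (h y)) has_real_derivative g' (h y) * h' y) (at y)"
    by eventually_elim (rule DERIV_chain2)
  moreover have "((\<lambda>y. g' (h y) * h' y) has_real_derivative e2 * d1\<^sup>2 + e1 * d2) (at x)"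
    by (rule DERIV_cong[OF DERIV_mult[OF DERIV_chain2[OF g'(3) hx] h'(3)]])
       (simp add: h'(2) g'(2) power2_eq_square)
  ultimately show ?thesis
    unfolding has_second_deriv_def using g'(2) h'(2)
    by (intro exI[of _ "\<lambda>y. g' (h y) * h' y"]) auto
qed

lemma has_second_deriv_affine: "has_second_deriv (\<lambda>x. c + x * k) k 0 x"
  by (rule has_second_derivI[where f' = "\<lambda>_. k"]) (auto intro!: derivative_eq_intros)

text \<open>The affine shape is a pointwise hypothesis so that arguments such as
  \<open>F + x * v + (F + x * w)\<close> qualify after plain algebra.\<close>

lemma has_second_deriv_compose_affine:
  assumes "has_second_deriv g e1 e2 c" "\<And>x. h x = c + x * k"
  shows "has_second_deriv (\<lambda>x. g (h x)) (e1 * k) (e2 * k\<^sup>2) 0"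
  using has_second_deriv_compose[where h = "\<lambda>x. c + x * k" and x = 0, OF _ has_second_deriv_affine]
    assms by fastforce

lemma smooth_on_has_second_deriv:
  assumes "smooth_on S f" "open S" "x \<in> S"
  shows "has_second_deriv f (deriv f x) (deriv (deriv f) x) x"
proof -
  have "f field_differentiable at y" "deriv f field_differentiable at y" if "y \<in> S" for y
  proof -
    have "\<And>n. (deriv ^^ n) f field_differentiable at y"
      using assms(1) that by (simp add: smooth_on_def)
    from this[of 0] this[of 1] show "f field_differentiable at y" "deriv f field_differentiable at y"
      by simp_all
  qed
  then have "\<And>y. y \<in> S \<Longrightarrow> (f has_real_derivative deriv f y) (at y)"
    "(deriv f has_real_derivative deriv (deriv f) x) (at x)"
    using assms(3) by (auto intro: field_differentiable_derivI)
  then show ?thesis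
    unfolding has_second_deriv_def using eventually_nhds_in_open[OF assms(2,3)]
    by (intro exI[of _ "deriv f"]) (auto elim: eventually_mono)
qed

section \<open>Strains of periodic displacements\<close>

lemma finite_cell [simp]: "finite (cell N)"
  by (simp add: cell_def)

lemma card_cell [simp]: "card (cell N) = 2 * N"
  by (simp add: cell_def)

lemma eps_pos: "N \<ge> 1 \<Longrightarrow> eps N > 0"
  by (simp add: eps_def)

text \<open>The reference strain is constantly \<open>F\<close>, and both variations point along
  \<open>u\<close>, so \<open>s\<close> and \<open>t\<close> enter only through their sum.\<close>

lemma diff_quot_perturbed:
  assumes "N \<ge> 1"
  shows "diff_quot N (\<lambda>l. uniform_deformation F N l + s * u l + t * u l)
           = (\<lambda>l. F + (s + t) * diff_quot N u l)"
proof
  fix l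
  show "diff_quot N (\<lambda>l. uniform_deformation F N l + s * u l + t * u l) l
           = F + (s + t) * diff_quot N u l"
    using eps_pos[OF assms] unfolding diff_quot_def uniform_deformation_def
    by (simp add: field_simps)
qed

lemma diff_quot_displacement_periodic:
  assumes "u \<in> displacements N"
  shows "diff_quot N u (l + 2 * int N) = diff_quot N u l"
proof -
  have per: "\<And>j. u (j + 2 * int N) = u j"
    using assms by (simp add: displacements_def)
  show ?thesis
    using per[of l] per[of "l - 1"] by (simp add: diff_quot_def algebra_simps)
qed

lemma periodic_int_shift:
  fixes v :: "int \<Rightarrow> 'a"
  assumes per: "\<And>l. v (l + p) = v l"
  shows "v (l + k * p) = v l"
proof (induction k rule: int_induct[where k = 0])
  case (step1 i)
  have "v (l + (i + 1) * p) = v ((l + i * p) + p)" by (simp add: algebra_simps)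
  then show ?case using step1 per by simp
next
  case (step2 i)
  have "v (l + i * p) = v ((l + (i - 1) * p) + p)" by (simp add: algebra_simps)
  then show ?case using step2 per by simp
qed simp

lemma periodic_value_in_cell:
  fixes v :: "int \<Rightarrow> real"
  assumes "N \<ge> 1" and per: "\<And>l. v (l + 2 * int N) = v l"
  obtains j where "j \<in> cell N" "v l = v j"
proof
  \<comment> \<open>The offset \<open>int N - 1\<close> carries the residues 0 to 2N - 1 onto -N + 1
    to N.\<close>
  define j where "j = (l + int N - 1) mod (2 * int N) - int N + 1"
  have "0 \<le> (l + int N - 1) mod (2 * int N)" "(l + int N - 1) mod (2 * int N) < 2 * int N"
    using assms(1) by auto
  then show "j \<in> cell N"
    unfolding j_def cell_def by auto
  have "l = j + ((l + int N - 1) div (2 * int N)) * (2 * int N)"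
    unfolding j_def using div_mult_mod_eq[of "l + int N - 1" "2 * int N"] by linarith
  then show "v l = v j"
    using periodic_int_shift[of v "2 * int N", OF per] by metis
qed

text \<open>Shifting the window trades the index -N + 1 for N + 1, which is one period
  later.\<close>

lemma sum_cell_shift:
  fixes f :: "int \<Rightarrow> real"
  assumes "N \<ge> 1" and per: "\<And>l. f (l + 2 * int N) = f l"
  shows "(\<Sum>l\<in>cell N. f (l + 1)) = (\<Sum>l\<in>cell N. f l)"
proof -
  have "(\<Sum>l\<in>cell N. f (l + 1)) = (\<Sum>l\<in>{- int N + 2 .. int N + 1}. f l)"
    by (rule sum.reindex_bij_witness[of _ "\<lambda>l. l - 1" "\<lambda>l. l + 1"]) (auto simp: cell_def)
  also have "{- int N + 2 .. int N + 1} = insert (int N + 1) {- int N + 2 .. int N}"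
    using assms(1) by auto
  also have "(\<Sum>l\<in>\<dots>. f l) = f (int N + 1) + (\<Sum>l\<in>{- int N + 2 .. int N}. f l)"
    by simp
  also have "f (int N + 1) = f (- int N + 1)"
    using per[of "- int N + 1"] by (simp add: algebra_simps)
  also have "f (- int N + 1) + (\<Sum>l\<in>{- int N + 2 .. int N}. f l)
               = (\<Sum>l\<in>insert (- int N + 1) {- int N + 2 .. int N}. f l)"
    by simp
  also have "insert (- int N + 1) {- int N + 2 .. int N} = cell N"
    using assms(1) by (auto simp: cell_def)
  finally show ?thesis .
qed

lemma l2_norm_eq_1_iff: "l2_norm N v = 1 \<longleftrightarrow> eps N * (\<Sum>l\<in>cell N. (v l)\<^sup>2) = 1"
  by (simp add: l2_norm_def)

definition unit_displacements :: "nat \<Rightarrow> (int \<Rightarrow> real) set" where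
  "unit_displacements N = {u \<in> displacements N. l2_norm N (diff_quot N u) = 1}"

text \<open>One squared strain is at most the sum over the cell, which the normalisation fixes at 1
  / \<open>eps N\<close> = N. This is the source of all lower bounds on the Hessians.\<close>

lemma unit_displacement_strain_bound:
  assumes "N \<ge> 1" "u \<in> unit_displacements N"
  shows "(diff_quot N u l)\<^sup>2 \<le> real N"
proof -
  let ?v = "diff_quot N u"
  have u: "u \<in> displacements N" "eps N * (\<Sum>l\<in>cell N. (?v l)\<^sup>2) = 1"
    using assms(2) by (simp_all add: unit_displacements_def l2_norm_eq_1_iff)
  obtain j where j: "j \<in> cell N" "?v l = ?v j"
    using periodic_value_in_cell[of N ?v l, OF assms(1) diff_quot_displacement_periodic[OF u(1)]] .
  have "(?v j)\<^sup>2 \<le> (\<Sum>l\<in>cell N. (?v l)\<^sup>2)"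
    by (rule member_le_sum[OF j(1)]) auto
  also have "\<dots> = real N"
    using u(2) assms(1) by (simp add: eps_def field_simps)
  finally show ?thesis using j(2) by simp
qed

lemma stability_const_unit:
  "stability_const F N E
     = (INF u\<in>unit_displacements N. second_variation E (uniform_deformation F N) u u)"
  by (simp add: stability_const_def unit_displacements_def)

text \<open>The bound \<open>C\<close> may be crude: it only ensures that the real infimum lies
  below every member of the family.\<close>

lemma stability_const_le:
  assumes "u \<in> unit_displacements N"
    and "\<And>w. w \<in> unit_displacements N \<Longrightarrow> C \<le> second_variation E (uniform_deformation F N) w w"
  shows "stability_const F N E \<le> second_variation E (uniform_deformation F N) u u"
  unfolding stability_const_unit using assms by (intro cINF_lower bdd_belowI2) auto

section \<open>Test displacements\<close>

text \<open>The amplitude makes every strain 1/sqrt 2 up to sign, so that 2N squares of 1/2,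
  weighted by 1/N, add up to 1.\<close>

definition alternating :: "nat \<Rightarrow> int \<Rightarrow> real" where
  "alternating N l = (if even l then 1 else -1) / (2 * sqrt 2 * real N)"

lemma diff_quot_alternating:
  "N \<ge> 1 \<Longrightarrow> diff_quot N (alternating N) l = (if even l then 1 else -1) / sqrt 2"
  by (simp add: diff_quot_def alternating_def eps_def field_simps)

lemma sum_cell_alternating: "(\<Sum>l\<in>cell N. alternating N l) = 0"
proof -
  \<comment> \<open>The reflection \<open>l \<mapsto> 1 - l\<close> maps the cell to itself and flips the parity.\<close>
  have "(\<Sum>l\<in>cell N. alternating N l) = (\<Sum>l\<in>cell N. alternating N (1 - l))"
    by (rule sum.reindex_bij_witness[of _ "\<lambda>l. 1 - l" "\<lambda>l. 1 - l"]) (auto simp: cell_def)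
  also have "\<dots> = (\<Sum>l\<in>cell N. - alternating N l)"
    by (rule sum.cong) (auto simp: alternating_def)
  finally show ?thesis by (simp add: sum_negf)
qed

lemma alternating_unit:
  assumes "N \<ge> 1"
  shows "alternating N \<in> unit_displacements N"
proof -
  have "alternating N \<in> displacements N"
    using sum_cell_alternating by (simp add: displacements_def alternating_def)
  moreover have "(\<Sum>l\<in>cell N. (diff_quot N (alternating N) l)\<^sup>2) = (\<Sum>l\<in>cell N. 1/2)"
    using assms by (intro sum.cong) (auto simp: diff_quot_alternating power_divide)
  ultimately show ?thesis
    using assms by (simp add: unit_displacements_def l2_norm_eq_1_iff eps_def)
qed

text \<open>The strain of \<open>bump\<close> is supported on the bonds 2 and 3 of the cell. Centering it there,
  rather than at the origin, keeps the reflected left half \<open>l < 0\<close> of the QNL energy at rest.\<close>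

definition bump :: "nat \<Rightarrow> int \<Rightarrow> real" where
  "bump N l = ((if l mod (2 * int N) = 2 then 1 else 0) - 1 / (2 * real N)) / sqrt (2 * real N)"

lemma diff_quot_bump:
  assumes "N \<ge> 4" "- int N \<le> l" "l \<le> int N + 2"
  shows "diff_quot N (bump N) l
           = (if l = 2 then sqrt (real N / 2) else if l = 3 then - sqrt (real N / 2) else 0)"
proof -
  \<comment> \<open>Difference quotients at -N to N + 2 read values from -N - 1 to N + 2. The
    neighbouring copies of the peak sit at 2 - 2N and 2 + 2N; the left one stays below -N - 1
    because N >= 4.\<close>
  have mod2: "j mod (2 * int N) = 2 \<longleftrightarrow> j = 2" if "- int N - 1 \<le> j" "j \<le> int N + 2" for j
  proof (cases "0 \<le> j")
    case True
    then show ?thesis using that assms(1) by simp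
  next
    case False
    then have "j mod (2 * int N) = j + 2 * int N"
      using that assms(1) mod_pos_pos_trivial[of "j + 2 * int N" "2 * int N"] by simp
    then show ?thesis using that assms(1) False by simp
  qed
  have "real N / sqrt (2 * real N) = sqrt (real N / 2)"
    using assms(1) by (simp add: real_sqrt_mult real_sqrt_divide real_div_sqrt divide_simps)
  moreover have "diff_quot N (bump N) l
      = ((if l = 2 then 1 else 0) - (if l = 3 then 1 else 0)) * (real N / sqrt (2 * real N))"
    unfolding diff_quot_def bump_def eps_def using assms mod2[of l] mod2[of "l - 1"]
    by (simp add: diff_divide_distrib algebra_simps)
  ultimately show ?thesis by simp
qed

text \<open>Exactly one cell index is 2 modulo 2N, so subtracting 1/(2N) gives mean zero; the two
  nonzero strains have square N/2 each, hence unit norm.\<close>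

lemma bump_unit:
  assumes "N \<ge> 4"
  shows "bump N \<in> unit_displacements N"
proof -
  have "(\<Sum>l\<in>cell N. if l mod (2 * int N) = 2 then 1 else 0 :: real)
          = (\<Sum>l\<in>{2}. if l mod (2 * int N) = 2 then 1 else 0)"
  proof (rule sum.mono_neutral_right)
    show "\<forall>l\<in>cell N - {2}. (if l mod (2 * int N) = 2 then 1 else 0) = (0 :: real)"
    proof
      fix l assume l: "l \<in> cell N - {2}"
      have "l mod (2 * int N) \<noteq> 2"
      proof (cases "0 \<le> l")
        case True
        then show ?thesis using l assms by (simp add: cell_def)
      next
        case False
        then have "l mod (2 * int N) = l + 2 * int N"
          using l assms mod_pos_pos_trivial[of "l + 2 * int N" "2 * int N"] by (simp add: cell_def)
        then show ?thesis using l assms by (simp add: cell_def)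
      qed
      then show "(if l mod (2 * int N) = 2 then 1 else 0) = (0 :: real)" by simp
    qed
  qed (use assms in \<open>auto simp: cell_def\<close>)
  also have "\<dots> = 1" using assms by simp
  finally have "(\<Sum>l\<in>cell N. bump N l) = 0"
    unfolding bump_def sum_divide_distrib[symmetric] using assms
    by (simp add: sum_subtractf)
  then have "bump N \<in> displacements N"
    by (simp add: displacements_def bump_def)
  moreover have "(\<Sum>l\<in>cell N. (diff_quot N (bump N) l)\<^sup>2)
      = (\<Sum>l\<in>{2,3}. (diff_quot N (bump N) l)\<^sup>2)"
    using assms by (intro sum.mono_neutral_right) (auto simp: cell_def diff_quot_bump)
  moreover have "\<dots> = real N"
    using assms by (simp add: diff_quot_bump)
  ultimately show ?thesis
    using assms by (simp add: unit_displacements_def l2_norm_eq_1_iff eps_def)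
qed

section \<open>Lower bounds for terms whose coefficients have no fixed sign\<close>

lemma scaled_ge_neg_abs:
  fixes c x m :: real
  assumes "0 \<le> x" "x \<le> m"
  shows "- (\<bar>c\<bar> * m) \<le> c * x"
proof -
  have "- (c * x) \<le> \<bar>c\<bar> * x" using abs_ge_minus_self[of "c * x"] assms(1) by (simp add: abs_mult)
  also have "\<dots> \<le> \<bar>c\<bar> * m" using assms(2) by (rule mult_left_mono) simp
  finally show ?thesis by simp
qed

lemma sum_power2_bound:
  fixes x y m :: real
  assumes "x\<^sup>2 \<le> m" "y\<^sup>2 \<le> m"
  shows "(x + y)\<^sup>2 \<le> 4 * m"
proof -
  have "(x + y)\<^sup>2 \<le> 2 * x\<^sup>2 + 2 * y\<^sup>2"
    using zero_le_power2[of "x - y"] unfolding power2_sum power2_diff by linarith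
  then show ?thesis using assms by linarith
qed

section \<open>Hessians at the uniform deformation\<close>

text \<open>Turns the mixed derivative in \<open>s\<close> and \<open>t\<close> into an iterated
  one. It holds even where \<open>h\<close> is not differentiable, since both sides choose from
  equivalent predicates.\<close>

lemma deriv_shift_arg: "deriv (\<lambda>t. h (s + t)) 0 = deriv h (s :: real)"
  unfolding deriv_def using DERIV_shift[of h _ 0 s] by (simp add: add.commute)

lemma second_variation_strain:
  assumes "N \<ge> 1"
    and "\<And>y. E y = eps N * (\<Sum>l\<in>cell N. e l (diff_quot N y))"
    and "\<And>l. has_second_deriv (\<lambda>x. e l (\<lambda>j. F + x * diff_quot N u j)) (d l) (q l) 0"
  shows "second_variation E (uniform_deformation F N) u u = eps N * (\<Sum>l\<in>cell N. q l)"
proof -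
  define h where "h x = eps N * (\<Sum>l\<in>cell N. e l (\<lambda>j. F + x * diff_quot N u j))" for x
  have "second_variation E (uniform_deformation F N) u u
          = deriv (\<lambda>s. deriv (\<lambda>t. h (s + t)) 0) 0"
    unfolding second_variation_def assms(2) diff_quot_perturbed[OF assms(1)] h_def ..
  also have "\<dots> = deriv (deriv h) 0"
    by (simp add: deriv_shift_arg)
  also have "\<dots> = eps N * (\<Sum>l\<in>cell N. q l)"
    unfolding h_def
    by (rule has_second_deriv_imp_deriv_deriv has_second_deriv_cmult has_second_deriv_sum
        finite_cell assms(3))+
  finally show ?thesis .
qed

text \<open>Names the Taylor data: \<open>p1\<close>, \<open>p2\<close> are the second derivatives
  of \<phi> at F and 2F; \<open>a\<close>, \<open>b\<close> and \<open>r1\<close>, \<open>r2\<close>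
  the first and second derivatives of \<rho> there; \<open>g1\<close>, \<open>g2\<close> those of
  \<open>G\<close> at the uniform density.\<close>

locale eam_expansion =
  fixes \<phi> \<rho> G :: "real \<Rightarrow> real" and F \<phi>1 \<phi>2 p1 p2 a b r1 r2 g1 g2 :: real
  assumes phi_F: "has_second_deriv \<phi> \<phi>1 p1 F" and phi_2F: "has_second_deriv \<phi> \<phi>2 p2 (2 * F)"
    and rho_F: "has_second_deriv \<rho> a r1 F" and rho_2F: "has_second_deriv \<rho> b r2 (2 * F)"
    and G_F: "has_second_deriv G g1 g2 (dens_uniform \<rho> F)"
    and g2_nonneg: "0 \<le> g2"
begin

text \<open>Curvatures of the nearest (\<alpha>) and next-nearest (\<beta>) terms: half of each pair
  bond belongs to one atom, plus the density curvature weighted by \<open>g1\<close>.\<close>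

definition "\<alpha> = p1 / 2 + g1 * r1"
definition "\<beta> = p2 / 2 + g1 * r2"

text \<open>The \<open>g2\<close> part is the squared first variation of the density; its second
  variation is absorbed into \<alpha> and \<beta>. The forms below are organised likewise.\<close>

definition quad_a :: "(int \<Rightarrow> real) \<Rightarrow> int \<Rightarrow> real" where
  "quad_a v l = g2 * (a * (v l + v (l+1)) + b * (v l + v (l-1) + v (l+1) + v (l+2)))\<^sup>2
     + \<alpha> * ((v l)\<^sup>2 + (v (l+1))\<^sup>2) + \<beta> * ((v l + v (l-1))\<^sup>2 + (v (l+1) + v (l+2))\<^sup>2)"

text \<open>The doubled strain turns \<beta> into 4 \<beta>, and half of
  \<open>g2 * (2 * a + 4 * b)\<^sup>2\<close> is the last term. Different bonds do not
  couple.\<close>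

definition quad_c :: "(int \<Rightarrow> real) \<Rightarrow> int \<Rightarrow> real" where
  "quad_c v l = (\<alpha> + 4 * \<beta> + 2 * g2 * (a + 2 * b)\<^sup>2) * ((v l)\<^sup>2 + (v (l+1))\<^sup>2)"

definition quad_interface :: "(int \<Rightarrow> real) \<Rightarrow> int \<Rightarrow> real" where
  "quad_interface v l = 2 * g2 * (a * v l + b * (v l + v (l-1)))\<^sup>2
     + 2 * g2 * (a + 2 * b)\<^sup>2 * (v (l+1))\<^sup>2
     + \<alpha> * ((v l)\<^sup>2 + (v (l+1))\<^sup>2) + \<beta> * ((v l + v (l-1))\<^sup>2 + 4 * (v (l+1))\<^sup>2)"

definition quad_qnl_right :: "nat \<Rightarrow> (int \<Rightarrow> real) \<Rightarrow> int \<Rightarrow> real" where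
  "quad_qnl_right K v l = (if l \<le> int K then quad_a v l
     else if l \<le> int K + 2 then quad_interface v l else quad_c v l)"

definition quad_qnl :: "nat \<Rightarrow> (int \<Rightarrow> real) \<Rightarrow> int \<Rightarrow> real" where
  "quad_qnl K v l = (if 0 \<le> l then quad_qnl_right K v l
     else quad_qnl_right K (\<lambda>j. v (1 - j)) (- l))"

section \<open>Second-order expansions of pair, density and embedding terms\<close>

lemma nearest_term:
  assumes "has_second_deriv f e1 e2 F"
  shows "has_second_deriv (\<lambda>x. f (F + x * v)) (e1 * v) (e2 * v\<^sup>2) 0"
  by (rule has_second_deriv_compose_affine[OF assms]) simp

lemma next_nearest_term:
  assumes "has_second_deriv f e1 e2 (2 * F)"
  shows "has_second_deriv (\<lambda>x. f (F + x * v + (F + x * w))) (e1 * (v + w)) (e2 * (v + w)\<^sup>2) 0"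
  by (rule has_second_deriv_compose_affine[OF assms]) (simp add: algebra_simps)

lemma doubled_term:
  assumes "has_second_deriv f e1 e2 (2 * F)"
  shows "has_second_deriv (\<lambda>x. f (2 * (F + x * v))) (e1 * (2 * v)) (e2 * (2 * v)\<^sup>2) 0"
  by (rule has_second_deriv_compose_affine[OF assms]) (simp add: algebra_simps)

lemmas pair_terms = nearest_term[OF phi_F] next_nearest_term[OF phi_2F] doubled_term[OF phi_2F]
lemmas density_terms = nearest_term[OF rho_F] next_nearest_term[OF rho_2F] doubled_term[OF rho_2F]

lemma embedding_term:
  assumes "has_second_deriv h d1 d2 0" "h 0 = dens_uniform \<rho> F"
  shows "has_second_deriv (\<lambda>x. G (h x)) (g1 * d1) (g2 * d1\<^sup>2 + g1 * d2) 0"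
  using has_second_deriv_compose[OF _ assms(1)] G_F assms(2) by simp

lemma dens_a_expansion:
  "has_second_deriv (\<lambda>x. dens_a \<rho> (\<lambda>j. F + x * v j) l)
     (a * (v l + v (l+1)) + b * (v l + v (l-1) + v (l+1) + v (l+2)))
     (r1 * ((v l)\<^sup>2 + (v (l+1))\<^sup>2) + r2 * ((v l + v (l-1))\<^sup>2 + (v (l+1) + v (l+2))\<^sup>2)) 0"
  unfolding dens_a_def
  by (rule has_second_deriv_cong, (rule has_second_deriv_add density_terms)+)
     (simp_all add: algebra_simps)

lemma dens_c_expansion:
  "has_second_deriv (\<lambda>x. dens_c \<rho> (\<lambda>j. F + x * v j) l)
     ((2 * a + 4 * b) * v l) ((2 * r1 + 8 * r2) * (v l)\<^sup>2) 0"
  unfolding dens_c_def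
  by (rule has_second_deriv_cong, (rule has_second_deriv_add has_second_deriv_cmult density_terms)+)
     (simp_all add: algebra_simps)

lemma dens_qnl_expansion:
  "has_second_deriv (\<lambda>x. dens_qnl \<rho> (\<lambda>j. F + x * v j) l)
     (2 * (a * v l + b * (v l + v (l-1)))) (2 * r1 * (v l)\<^sup>2 + 2 * r2 * (v l + v (l-1))\<^sup>2) 0"
  unfolding dens_qnl_def
  by (rule has_second_deriv_cong, (rule has_second_deriv_add has_second_deriv_cmult density_terms)+)
     (simp_all add: algebra_simps)

lemma dens_at_uniform:
  "dens_a \<rho> (\<lambda>j. F + 0 * v j) l = dens_uniform \<rho> F"
  "dens_c \<rho> (\<lambda>j. F + 0 * v j) l = dens_uniform \<rho> F"
  "dens_qnl \<rho> (\<lambda>j. F + 0 * v j) l = dens_uniform \<rho> F"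
  by (simp_all add: dens_a_def dens_c_def dens_qnl_def dens_uniform_def)

lemmas embedding_terms =
  embedding_term[OF dens_a_expansion dens_at_uniform(1)]
  embedding_term[OF dens_c_expansion dens_at_uniform(2)]
  embedding_term[OF dens_qnl_expansion dens_at_uniform(3)]

text \<open>The first-order coefficient does not enter the Hessian; it is left existential and
  determined by unification, with \<open>rule refl\<close> closing its equation.\<close>

lemma atom_a_expansion:
  "\<exists>d. has_second_deriv (\<lambda>x. atom_a \<phi> \<rho> G (\<lambda>j. F + x * v j) l) d (quad_a v l) 0"
  unfolding atom_a_def
  by (rule exI, rule has_second_deriv_cong,
      (rule has_second_deriv_add has_second_deriv_cmult pair_terms embedding_terms)+, rule refl)
     (simp add: quad_a_def \<alpha>_def \<beta>_def field_simps)

lemma atom_c_expansion: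
  "\<exists>d. has_second_deriv (\<lambda>x. atom_c \<phi> \<rho> G (\<lambda>j. F + x * v j) l) d (quad_c v l) 0"
  unfolding atom_c_def
  by (rule exI, rule has_second_deriv_cong,
      (rule has_second_deriv_add has_second_deriv_cmult pair_terms embedding_terms)+, rule refl)
     (simp add: quad_c_def \<alpha>_def \<beta>_def field_simps power2_eq_square)

lemma atom_interface_expansion:
  "\<exists>d. has_second_deriv (\<lambda>x. atom_interface \<phi> \<rho> G (\<lambda>j. F + x * v j) l) d (quad_interface v l) 0"
  unfolding atom_interface_def
  by (rule exI, rule has_second_deriv_cong,
      (rule has_second_deriv_add has_second_deriv_cmult pair_terms embedding_terms)+, rule refl)
     (simp add: quad_interface_def \<alpha>_def \<beta>_def field_simps power2_eq_square)

lemma atom_qnl_right_expansion: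
  "\<exists>d. has_second_deriv (\<lambda>x. atom_qnl_right \<phi> \<rho> G K (\<lambda>j. F + x * v j) l) d (quad_qnl_right K v l) 0"
  unfolding atom_qnl_right_def quad_qnl_right_def
  using atom_a_expansion atom_c_expansion atom_interface_expansion by simp

text \<open>Reflection fixes the uniform strain \<open>F\<close>, so the left half is the right-half
  expansion applied to the reflected \<open>v\<close>.\<close>

lemma atom_qnl_expansion:
  "\<exists>d. has_second_deriv (\<lambda>x. atom_qnl \<phi> \<rho> G K (\<lambda>j. F + x * v j) l) d (quad_qnl K v l) 0"
  unfolding atom_qnl_def quad_qnl_def
  using atom_qnl_right_expansion[of K v] atom_qnl_right_expansion[of K "\<lambda>j. v (1 - j)"] by simp

lemma second_variation_a:
  assumes "N \<ge> 1"
  shows "second_variation (energy_a \<phi> \<rho> G N) (uniform_deformation F N) u u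
           = eps N * (\<Sum>l\<in>cell N. quad_a (diff_quot N u) l)"
proof -
  obtain d where "\<And>l. has_second_deriv (\<lambda>x. atom_a \<phi> \<rho> G (\<lambda>j. F + x * diff_quot N u j) l) (d l)
      (quad_a (diff_quot N u) l) 0"
    using atom_a_expansion by metis
  then show ?thesis
    by (rule second_variation_strain[OF assms,
        where e = "\<lambda>l r. atom_a \<phi> \<rho> G r l", OF energy_a_def])
qed

lemma second_variation_c:
  assumes "N \<ge> 1"
  shows "second_variation (energy_qcl \<phi> \<rho> G N) (uniform_deformation F N) u u
           = eps N * (\<Sum>l\<in>cell N. quad_c (diff_quot N u) l)"
proof -
  obtain d where "\<And>l. has_second_deriv (\<lambda>x. atom_c \<phi> \<rho> G (\<lambda>j. F + x * diff_quot N u j) l) (d l)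
      (quad_c (diff_quot N u) l) 0"
    using atom_c_expansion by metis
  then show ?thesis
    by (rule second_variation_strain[OF assms,
        where e = "\<lambda>l r. atom_c \<phi> \<rho> G r l", OF energy_qcl_def])
qed

lemma second_variation_qnl:
  assumes "N \<ge> 1"
  shows "second_variation (energy_qnl \<phi> \<rho> G K N) (uniform_deformation F N) u u
           = eps N * (\<Sum>l\<in>cell N. quad_qnl K (diff_quot N u) l)"
proof -
  obtain d where "\<And>l. has_second_deriv (\<lambda>x. atom_qnl \<phi> \<rho> G K (\<lambda>j. F + x * diff_quot N u j) l) (d l)
      (quad_qnl K (diff_quot N u) l) 0"
    using atom_qnl_expansion by metis
  then show ?thesis
    by (rule second_variation_strain[OF assms,
        where e = "\<lambda>l r. atom_qnl \<phi> \<rho> G K r l", OF energy_qnl_def])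
qed

text \<open>The real \<open>INF\<close> lies below its members only if the family is bounded below; a bound that
  depends on \<open>N\<close> suffices.\<close>

lemma quad_lower_bounds:
  assumes v: "\<And>j. (v j)\<^sup>2 \<le> m"
  defines "L \<equiv> - (\<bar>\<alpha>\<bar> * (2 * m)) - \<bar>\<beta>\<bar> * (8 * m)"
  shows "L \<le> quad_a v l" "L \<le> quad_c v l" "L \<le> quad_interface v l"
proof -
  \<comment> \<open>Two squared strains of size at most \<open>m\<close> give \<open>2 * m\<close>.
    The \<beta> terms below reach \<open>8 * m\<close>, as squared pair sums and doubled strains are
    at most \<open>4 * m\<close> each. The \<open>g2\<close> terms are nonnegative.\<close>
  have A: "- (\<bar>\<alpha>\<bar> * (2 * m)) \<le> \<alpha> * ((v l)\<^sup>2 + (v (l+1))\<^sup>2)"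
    by (rule scaled_ge_neg_abs) (use v[of l] v[of "l+1"] in auto)
  have s: "\<And>i j. (v i + v j)\<^sup>2 \<le> 4 * m"
    by (rule sum_power2_bound[OF v v])
  have "- (\<bar>\<beta>\<bar> * (8 * m)) \<le> \<beta> * ((v l + v (l-1))\<^sup>2 + (v (l+1) + v (l+2))\<^sup>2)"
    by (rule scaled_ge_neg_abs) (use s[of l "l-1"] s[of "l+1" "l+2"] in auto)
  moreover have "0 \<le> g2 * (a * (v l + v (l+1)) + b * (v l + v (l-1) + v (l+1) + v (l+2)))\<^sup>2"
    using g2_nonneg by simp
  ultimately show "L \<le> quad_a v l"
    unfolding quad_a_def L_def using A by linarith
  have "- (\<bar>\<beta>\<bar> * (8 * m)) \<le> \<beta> * (4 * (v l)\<^sup>2 + 4 * (v (l+1))\<^sup>2)"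
    by (rule scaled_ge_neg_abs) (use v[of l] v[of "l+1"] in auto)
  moreover have "0 \<le> 2 * g2 * (a + 2 * b)\<^sup>2 * ((v l)\<^sup>2 + (v (l+1))\<^sup>2)"
    using g2_nonneg by simp
  moreover have "quad_c v l = \<alpha> * ((v l)\<^sup>2 + (v (l+1))\<^sup>2)
      + \<beta> * (4 * (v l)\<^sup>2 + 4 * (v (l+1))\<^sup>2) + 2 * g2 * (a + 2 * b)\<^sup>2 * ((v l)\<^sup>2 + (v (l+1))\<^sup>2)"
    unfolding quad_c_def by (simp add: algebra_simps)
  ultimately show "L \<le> quad_c v l"
    unfolding L_def using A by linarith
  have "- (\<bar>\<beta>\<bar> * (8 * m)) \<le> \<beta> * ((v l + v (l-1))\<^sup>2 + 4 * (v (l+1))\<^sup>2)"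
    by (rule scaled_ge_neg_abs) (use s[of l "l-1"] v[of "l+1"] in auto)
  moreover have "0 \<le> 2 * g2 * (a * v l + b * (v l + v (l-1)))\<^sup>2"
    "0 \<le> 2 * g2 * (a + 2 * b)\<^sup>2 * (v (l+1))\<^sup>2"
    using g2_nonneg by simp_all
  ultimately show "L \<le> quad_interface v l"
    unfolding quad_interface_def L_def using A by linarith
qed

lemma quad_qnl_lower_bound:
  assumes "\<And>j. (v j)\<^sup>2 \<le> m"
  shows "- (\<bar>\<alpha>\<bar> * (2 * m)) - \<bar>\<beta>\<bar> * (8 * m) \<le> quad_qnl K v l"
  unfolding quad_qnl_def quad_qnl_right_def
  using quad_lower_bounds[of v m] quad_lower_bounds[of "\<lambda>j. v (1 - j)" m] assms by simp

section \<open>Stability constants\<close>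

text \<open>By periodicity the shifted squares have the same sum, so the second variation is
  constant on the unit displacements.\<close>

lemma stability_const_qcl:
  assumes "N \<ge> 1"
  shows "stability_const F N (energy_qcl \<phi> \<rho> G N) = 2 * \<alpha> + 4 * (2 * \<beta> + g2 * (a + 2 * b)\<^sup>2)"
proof -
  have "second_variation (energy_qcl \<phi> \<rho> G N) (uniform_deformation F N) u u
          = 2 * \<alpha> + 4 * (2 * \<beta> + g2 * (a + 2 * b)\<^sup>2)"
    if u: "u \<in> unit_displacements N" for u
  proof -
    let ?v = "diff_quot N u" and ?c = "\<alpha> + 4 * \<beta> + 2 * g2 * (a + 2 * b)\<^sup>2"
    have u': "u \<in> displacements N" "eps N * (\<Sum>l\<in>cell N. (?v l)\<^sup>2) = 1"
      using u by (simp_all add: unit_displacements_def l2_norm_eq_1_iff)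
    have "(\<Sum>l\<in>cell N. quad_c ?v l)
        = ?c * ((\<Sum>l\<in>cell N. (?v l)\<^sup>2) + (\<Sum>l\<in>cell N. (?v (l+1))\<^sup>2))"
      unfolding quad_c_def by (simp only: sum_distrib_left[symmetric] sum.distrib)
    also have "(\<Sum>l\<in>cell N. (?v (l+1))\<^sup>2) = (\<Sum>l\<in>cell N. (?v l)\<^sup>2)"
      by (rule sum_cell_shift[OF assms]) (simp add: diff_quot_displacement_periodic[OF u'(1)])
    finally have "eps N * (\<Sum>l\<in>cell N. quad_c ?v l)
        = 2 * ?c * (eps N * (\<Sum>l\<in>cell N. (?v l)\<^sup>2))"
      by simp
    then show ?thesis
      unfolding second_variation_c[OF assms] u'(2) by simp
  qed
  \<comment> \<open>The infimum of a constant family equals that constant only over a nonempty index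
    set.\<close>
  moreover have "unit_displacements N \<noteq> {}"
    using alternating_unit[OF assms] by blast
  ultimately show ?thesis
    unfolding stability_const_unit by (simp cong: INF_cong_simp)
qed

text \<open>On the alternating strain neighbouring bonds cancel, so the \<open>g2\<close> and
  \<beta> terms vanish and each of the 2N atoms contributes \<alpha>.\<close>

lemma stability_const_a_le:
  assumes "N \<ge> 1"
  shows "stability_const F N (energy_a \<phi> \<rho> G N) \<le> 2 * \<alpha>"
proof -
  have "stability_const F N (energy_a \<phi> \<rho> G N)
      \<le> second_variation (energy_a \<phi> \<rho> G N) (uniform_deformation F N) (alternating N) (alternating N)"
  proof (rule stability_const_le[OF alternating_unit[OF assms]])
    fix w assume "w \<in> unit_displacements N"
    then show "eps N * (\<Sum>l\<in>cell N. - (\<bar>\<alpha>\<bar> * (2 * real N)) - \<bar>\<beta>\<bar> * (8 * real N))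
        \<le> second_variation (energy_a \<phi> \<rho> G N) (uniform_deformation F N) w w"
      unfolding second_variation_a[OF assms] using unit_displacement_strain_bound[OF assms] assms
      by (intro mult_left_mono sum_mono quad_lower_bounds) (auto simp: eps_def)
  qed
  also have "\<dots> = eps N * (\<Sum>l\<in>cell N. \<alpha>)"
    unfolding second_variation_a[OF assms] quad_a_def
    by (rule arg_cong[where f = "\<lambda>x. eps N * x"], rule sum.cong)
       (auto simp: diff_quot_alternating[OF assms] power_divide)
  also have "\<dots> = 2 * \<alpha>"
    using assms by (simp add: eps_def)
  finally show ?thesis .
qed

lemma stability_const_qnl_le:
  assumes "K \<ge> 4" "N \<ge> K + 3"
  shows "stability_const F N (energy_qnl \<phi> \<rho> G K N) \<le> 2 * \<alpha> + 2 * \<beta> + g2 * (a\<^sup>2 + b\<^sup>2)"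
proof -
  have N: "N \<ge> 1" "N \<ge> 4" using assms by auto
  let ?v = "diff_quot N (bump N)"
  note v = diff_quot_bump[OF N(2)]
  have "stability_const F N (energy_qnl \<phi> \<rho> G K N)
      \<le> second_variation (energy_qnl \<phi> \<rho> G K N) (uniform_deformation F N) (bump N) (bump N)"
  proof (rule stability_const_le[OF bump_unit[OF N(2)]])
    fix w assume "w \<in> unit_displacements N"
    then show "eps N * (\<Sum>l\<in>cell N. - (\<bar>\<alpha>\<bar> * (2 * real N)) - \<bar>\<beta>\<bar> * (8 * real N))
        \<le> second_variation (energy_qnl \<phi> \<rho> G K N) (uniform_deformation F N) w w"
      unfolding second_variation_qnl[OF N(1)] using unit_displacement_strain_bound[OF N(1)] N(1)
      by (intro mult_left_mono sum_mono quad_qnl_lower_bound) (auto simp: eps_def)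
  qed
  also have "\<dots> = eps N * (\<Sum>l\<in>cell N. quad_qnl K ?v l)"
    by (rule second_variation_qnl[OF N(1)])
  \<comment> \<open>An atom \<open>l\<close> sees the bonds \<open>l - 1\<close> to
    \<open>l + 2\<close>, so only atoms 0 to 4 meet bond 2 or 3; since \<open>K\<close> >= 4 all
    five are atomistic.\<close>
  also have "(\<Sum>l\<in>cell N. quad_qnl K ?v l) = (\<Sum>l\<in>{0,1,2,3,4}. quad_qnl K ?v l)"
  proof (rule sum.mono_neutral_right)
    show "\<forall>l\<in>cell N - {0,1,2,3,4}. quad_qnl K ?v l = 0"
    proof
      fix l assume "l \<in> cell N - {0,1,2,3,4}"
      then have l: "- int N + 1 \<le> l" "l \<le> int N" "l < 0 \<or> l > 4"
        by (auto simp: cell_def)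
      \<comment> \<open>For \<open>l < 0\<close> the reflection only reverses the order of these
        four bonds, so the same zeros serve both halves.\<close>
      then have "?v (l - 1) = 0" "?v l = 0" "?v (l + 1) = 0" "?v (l + 2) = 0"
        by (auto simp: v)
      then show "quad_qnl K ?v l = 0"
        by (simp add: quad_qnl_def quad_qnl_right_def quad_a_def quad_c_def quad_interface_def
            algebra_simps)
    qed
  qed (use assms in \<open>auto simp: cell_def\<close>)
  \<comment> \<open>In units of N/2, atoms 0 and 4 give \<open>g2 * b\<^sup>2\<close> + \<beta>
    each, atoms 1 and 3 give \<open>g2 * a\<^sup>2\<close> + \<alpha> each, and atom 2 gives 2
    \<alpha> + 2 \<beta>.\<close>
  also have "\<dots> = real N * (2 * \<alpha> + 2 * \<beta> + g2 * (a\<^sup>2 + b\<^sup>2))"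
    using assms
    by (simp add: quad_qnl_def quad_qnl_right_def quad_a_def v power_mult_distrib algebra_simps)
  also have "eps N * \<dots> = 2 * \<alpha> + 2 * \<beta> + g2 * (a\<^sup>2 + b\<^sup>2)"
    using N(1) by (simp add: eps_def)
  finally show ?thesis .
qed

end

section \<open>Comparison of the three stability constants\<close>

theorem mainTheorem3:
  fixes \<phi> \<rho> G :: "real \<Rightarrow> real" and F :: real
  assumes "F > 0"
    and "smooth_on {0<..} \<phi>" and "smooth_on {0<..} \<rho>" and "smooth_on UNIV G"
    and "deriv (deriv \<phi>) F > 0" and "deriv (deriv \<phi>) (2 * F) < 0"
    and "deriv \<rho> F \<le> 0" and "deriv \<rho> (2 * F) \<le> 0"
    and "deriv (deriv \<rho>) F \<ge> 0" and "deriv (deriv \<rho>) (2 * F) \<ge> 0"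
    and "deriv (deriv G) (dens_uniform \<rho> F) \<ge> 0"
    and "deriv (deriv \<phi>) (2 * F)
           + deriv (deriv G) (dens_uniform \<rho> F) * (deriv \<rho> F + 2 * deriv \<rho> (2 * F))\<^sup>2
           + 2 * deriv G (dens_uniform \<rho> F) * deriv (deriv \<rho>) (2 * F) > 0"
  shows "(deriv (deriv \<phi>) (2 * F)
           + deriv (deriv G) (dens_uniform \<rho> F)
             * ((deriv \<rho> F)\<^sup>2 + 20 * (deriv \<rho> (2 * F))\<^sup>2 + 12 * deriv \<rho> F * deriv \<rho> (2 * F))
           + 2 * deriv G (dens_uniform \<rho> F) * deriv (deriv \<rho>) (2 * F) > 0)
    \<and> (\<forall>N::nat. N \<ge> 1 \<longrightarrow>
           stability_const F N (energy_qcl \<phi> \<rho> G N)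
             > deriv (deriv \<phi>) F + 2 * deriv G (dens_uniform \<rho> F) * deriv (deriv \<rho>) F
         \<and> deriv (deriv \<phi>) F + 2 * deriv G (dens_uniform \<rho> F) * deriv (deriv \<rho>) F
             \<ge> stability_const F N (energy_a \<phi> \<rho> G N))
    \<and> (\<exists>K\<^sub>0::nat. \<forall>K N. K \<ge> K\<^sub>0 \<and> N \<ge> K + 3 \<longrightarrow>
           stability_const F N (energy_qnl \<phi> \<rho> G K N)
             < stability_const F N (energy_qcl \<phi> \<rho> G N))"
proof -
  let ?\<phi>2 = "deriv (deriv \<phi>)" and ?\<rho>1 = "deriv \<rho>" and ?\<rho>2 = "deriv (deriv \<rho>)"
  let ?g1 = "deriv G (dens_uniform \<rho> F)" and ?g2 = "deriv (deriv G) (dens_uniform \<rho> F)"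
  let ?a = "?\<rho>1 F" and ?b = "?\<rho>1 (2 * F)"
  let ?\<alpha> = "eam_expansion.\<alpha> (?\<phi>2 F) (?\<rho>2 F) ?g1"
  let ?\<beta> = "eam_expansion.\<beta> (?\<phi>2 (2 * F)) (?\<rho>2 (2 * F)) ?g1"
  have eam: "eam_expansion \<phi> \<rho> G F (deriv \<phi> F) (deriv \<phi> (2 * F)) (?\<phi>2 F) (?\<phi>2 (2 * F))
      ?a ?b (?\<rho>2 F) (?\<rho>2 (2 * F)) ?g1 ?g2"
    by unfold_locales (use assms in \<open>auto intro!: smooth_on_has_second_deriv\<close>)
  note stability = eam_expansion.stability_const_qcl[OF eam]
    eam_expansion.stability_const_a_le[OF eam] eam_expansion.stability_const_qnl_le[OF eam]
  have \<alpha>: "2 * ?\<alpha> = ?\<phi>2 F + 2 * ?g1 * ?\<rho>2 F"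
    by (simp add: eam_expansion.\<alpha>_def[OF eam])
  have gap: "2 * ?\<beta> + ?g2 * (?a + 2 * ?b)\<^sup>2 > 0"
    using assms(12) by (simp add: eam_expansion.\<beta>_def[OF eam] distrib_left mult.assoc)
  have ab: "0 \<le> ?a * ?b"
    using assms(7,8) by (rule mult_nonpos_nonpos)
  \<comment> \<open>The brackets differ by 16 b^2 + 8 ab, which is nonnegative by
    \<open>ab\<close>.\<close>
  have "?g2 * (?a + 2 * ?b)\<^sup>2 \<le> ?g2 * (?a\<^sup>2 + 20 * ?b\<^sup>2 + 12 * ?a * ?b)"
    using assms(11) ab by (intro mult_left_mono) (auto simp: power2_sum)
  then have i: "?\<phi>2 (2 * F) + ?g2 * (?a\<^sup>2 + 20 * ?b\<^sup>2 + 12 * ?a * ?b) + 2 * ?g1 * ?\<rho>2 (2 * F) > 0"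
    using assms(12) by linarith
  \<comment> \<open>Here the difference is 3 b^2 + 4 ab.\<close>
  have "?g2 * (?a\<^sup>2 + ?b\<^sup>2) \<le> ?g2 * (?a + 2 * ?b)\<^sup>2"
    using assms(11) ab by (intro mult_left_mono) (auto simp: power2_sum)
  \<comment> \<open>Beyond 2 \<alpha>, the QNL side is at most one copy of the positive quantity in
    \<open>gap\<close>, while the QCL side has four; this gives strictness.\<close>
  then have "2 * ?\<alpha> + 2 * ?\<beta> + ?g2 * (?a\<^sup>2 + ?b\<^sup>2) < 2 * ?\<alpha> + 4 * (2 * ?\<beta> + ?g2 * (?a + 2 * ?b)\<^sup>2)"
    using gap by (simp only: distrib_left)
  then have "\<forall>K N. K \<ge> 4 \<and> N \<ge> K + 3 \<longrightarrow>
      stability_const F N (energy_qnl \<phi> \<rho> G K N) < stability_const F N (energy_qcl \<phi> \<rho> G N)"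
    using stability by (fastforce intro: le_less_trans)
  moreover have "\<forall>N\<ge>1. stability_const F N (energy_qcl \<phi> \<rho> G N) > ?\<phi>2 F + 2 * ?g1 * ?\<rho>2 F
      \<and> ?\<phi>2 F + 2 * ?g1 * ?\<rho>2 F \<ge> stability_const F N (energy_a \<phi> \<rho> G N)"
    using stability gap unfolding \<alpha>[symmetric] by simp
  ultimately show ?thesis
    using i by blast
qed

end
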